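(* Let $(G,i)$ be a rooted graph and $A \in \mathcal{S}(G)$. Then $A$ has $i$-SNIP if and only if the right kernel of $A(i,:]$ gives a full recipe from $G$.
   Context: All graphs are finite and simple. For a graph $G$ on $n$ vertices labeled $1,\dots,n$, $\mathcal{S}(G)$ is the set of $n\times n$ real symmetric matrices whose off-diagonal $(p,q)$-entry is nonzero iff $\{p,q\}\in E(G)$ (diagonal arbitrary). $A(i,:]$ is the $(n-1)\times n$ matrix obtained from $A$ by deleting row $i$; $(AX)(i,:]$ is $AX$ with row $i$ deleted; $\circ$ is the entrywise product. A symmetric $A$ has $i$-SNIP if the only real symmetric $X$ with $A\circ X=O$, $I\circ X=O$, $(AX)(i,:]=O$ is $X=O$. A subspace $L\subseteq\mathbb{R}^n$ of dimension $m$ gives a full recipe from $G$ if, for a matrix $N$ whose $m$ columns form a basis of $L$ and whose rows are $\mathbf{u}_1^\top,\dots,\mathbf{u}_n^\top$, the matrices $\mathbf{u}_j\mathbf{u}_j^\top$ for all vertices $j$ of $G$ together with $\mathbf{u}_j\mathbf{u}_k^\top + \mathbf{u}_k\mathbf{u}_j^\top$ for all edges $\{j,k\}$ of $G$ span the space of all $m\times m$ real symmetric matrices (this does not depend on the choice of basis). *)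

theory Defs
  imports Complex_Main "Jordan_Normal_Form.Matrix_Kernel" "Jordan_Normal_Form.VS_Connect"
begin

text \<open>Vertices are labelled \<open>0, \<dots>, n - 1\<close>, following the 0-based matrix indices of the library;
  an edge is a two-element set of vertices.\<close>

definition simple_graph :: "nat \<Rightarrow> nat set set \<Rightarrow> bool" where
  "simple_graph n E \<longleftrightarrow> (\<forall>e\<in>E. e \<subseteq> {0..<n} \<and> card e = 2)"

definition sym_mats :: "nat \<Rightarrow> real mat set" where
  "sym_mats n = {X \<in> carrier_mat n n. transpose_mat X = X}"

definition graph_mats :: "nat \<Rightarrow> nat set set \<Rightarrow> real mat set" where
  "graph_mats n E =
    {A \<in> sym_mats n. \<forall>p<n. \<forall>q<n. p \<noteq> q \<longrightarrow> (A $$ (p, q) \<noteq> 0 \<longleftrightarrow> {p, q} \<in> E)}"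

definition delete_row :: "nat \<Rightarrow> 'a mat \<Rightarrow> 'a mat" where
  "delete_row i A = mat (dim_row A - 1) (dim_col A) (\<lambda>(p, q). A $$ (insert_index i p, q))"

definition hadamard :: "real mat \<Rightarrow> real mat \<Rightarrow> real mat" where
  "hadamard A B = mat (dim_row A) (dim_col A) (\<lambda>(p, q). A $$ (p, q) * B $$ (p, q))"

text \<open>Meant for symmetric \<open>A\<close>.\<close>

definition has_SNIP :: "nat \<Rightarrow> real mat \<Rightarrow> bool" where
  "has_SNIP i A \<longleftrightarrow> (let n = dim_row A in
    \<forall>X\<in>sym_mats n.
      hadamard A X = 0\<^sub>m n n \<and> hadamard (1\<^sub>m n) X = 0\<^sub>m n n \<and>
      delete_row i (A * X) = 0\<^sub>m (n - 1) n \<longrightarrow> X = 0\<^sub>m n n)"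

definition outer_prod :: "real vec \<Rightarrow> real vec \<Rightarrow> real mat" where
  "outer_prod u v = mat (dim_vec u) (dim_vec v) (\<lambda>(a, b). u $ a * v $ b)"

text \<open>The \<open>distinct\<close> condition is needed since \<open>set (cols N)\<close> forgets repeated columns.\<close>

definition cols_form_basis :: "nat \<Rightarrow> nat \<Rightarrow> real mat \<Rightarrow> real vec set \<Rightarrow> bool" where
  "cols_form_basis n m N L \<longleftrightarrow>
    N \<in> carrier_mat n m \<and> distinct (cols N) \<and>
    \<not> module.lin_dep class_ring (module_vec TYPE(real) n) (set (cols N)) \<and>
    LinearCombinations.module.span class_ring (module_vec TYPE(real) n) (set (cols N)) = L"

definition recipe_mats :: "nat \<Rightarrow> nat set set \<Rightarrow> real mat \<Rightarrow> real mat set" where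
  "recipe_mats n E N =
    {outer_prod (row N j) (row N j) | j. j < n} \<union>
    {outer_prod (row N j) (row N k) + outer_prod (row N k) (row N j) | j k. {j, k} \<in> E}"

text \<open>The spanning condition does not depend on the chosen basis matrix \<open>N\<close>, and
  \<open>m\<close> is determined by \<open>L\<close>.\<close>

definition gives_full_recipe :: "nat \<Rightarrow> nat set set \<Rightarrow> real vec set \<Rightarrow> bool" where
  "gives_full_recipe n E L \<longleftrightarrow>
    (\<exists>m N. cols_form_basis n m N L \<and>
      LinearCombinations.module.span class_ring (module_mat TYPE(real) m m) (recipe_mats n E N)
        = sym_mats m)"

end

theory Submission
  imports Defs "Jordan_Normal_Form.DL_Rank"
begin

text \<open>Let the columns of \<open>N\<close> form a basis of the right kernel of \<open>A(i,:]\<close>. The symmetric \<open>X\<close> with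
  \<open>(AX)(i,:] = O\<close> are exactly the matrices \<open>N S N\<^sup>T\<close> with \<open>S\<close> symmetric, and \<open>S\<close> is determined
  by \<open>X\<close>. The \<open>(j,k)\<close> entry of \<open>N S N\<^sup>T\<close> is the Frobenius inner product of \<open>S\<close> with
  \<open>u\<^sub>j u\<^sub>k\<^sup>T\<close>, so the two Hadamard conditions on \<open>X\<close> say that \<open>S\<close> is orthogonal to all recipe
  matrices. Hence the i-SNIP says that the orthogonal complement of the recipe matrices within the
  symmetric matrices is trivial, that is, that they span.\<close>

section \<open>The Frobenius inner product\<close>

definition frob_inner :: "nat \<Rightarrow> nat \<Rightarrow> real mat \<Rightarrow> real mat \<Rightarrow> real" where
  "frob_inner nr nc S T = (\<Sum>a<nr. \<Sum>b<nc. S $$ (a, b) * T $$ (a, b))"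

lemma frob_inner_add_right:
  assumes "T \<in> carrier_mat nr nc" "U \<in> carrier_mat nr nc"
  shows "frob_inner nr nc S (T + U) = frob_inner nr nc S T + frob_inner nr nc S U"
  using assms by (simp add: frob_inner_def distrib_left sum.distrib)

lemma frob_inner_smult_right:
  assumes "T \<in> carrier_mat nr nc"
  shows "frob_inner nr nc S (c \<cdot>\<^sub>m T) = c * frob_inner nr nc S T"
  using assms by (simp add: frob_inner_def sum_distrib_left mult.left_commute)

lemma frob_inner_zero_right: "frob_inner nr nc S (0\<^sub>m nr nc) = 0"
  by (simp add: frob_inner_def)

lemma frob_inner_minus_left:
  assumes "S \<in> carrier_mat nr nc" "U \<in> carrier_mat nr nc"
  shows "frob_inner nr nc (S - U) T = frob_inner nr nc S T - frob_inner nr nc U T"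
  using assms by (simp add: frob_inner_def left_diff_distrib sum_subtractf)

lemma frob_inner_smult_left:
  assumes "S \<in> carrier_mat nr nc"
  shows "frob_inner nr nc (c \<cdot>\<^sub>m S) T = c * frob_inner nr nc S T"
  using assms by (simp add: frob_inner_def sum_distrib_left mult.assoc)

lemma frob_inner_self_eq_0:
  assumes "S \<in> carrier_mat nr nc" "frob_inner nr nc S S = 0"
  shows "S = 0\<^sub>m nr nc"
proof (rule eq_matI)
  fix a b assume "a < dim_row (0\<^sub>m nr nc :: real mat)" "b < dim_col (0\<^sub>m nr nc :: real mat)"
  hence ab: "a < nr" "b < nc" by auto
  have "\<forall>a\<in>{..<nr}. (\<Sum>b<nc. S $$ (a, b) * S $$ (a, b)) = 0"
    using assms(2) unfolding frob_inner_def
    by (subst (asm) sum_nonneg_eq_0_iff) (auto intro: sum_nonneg)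
  hence "(\<Sum>b<nc. S $$ (a, b) * S $$ (a, b)) = 0" using ab by auto
  hence "\<forall>b\<in>{..<nc}. S $$ (a, b) * S $$ (a, b) = 0"
    by (subst (asm) sum_nonneg_eq_0_iff) auto
  thus "S $$ (a, b) = 0\<^sub>m nr nc $$ (a, b)" using ab by auto
qed (use assms in auto)

section \<open>Spans and orthogonality in spaces of matrices\<close>

context
  fixes nr nc :: nat
begin

interpretation M: matrix_vs nr nc "TYPE(real)" .

lemma submodule_mat_iff:
  "submodule class_ring W (module_mat TYPE(real) nr nc) \<longleftrightarrow>
    W \<subseteq> carrier_mat nr nc \<and> 0\<^sub>m nr nc \<in> W \<and>
    (\<forall>X\<in>W. \<forall>Y\<in>W. X + Y \<in> W) \<and> (\<forall>c. \<forall>X\<in>W. c \<cdot>\<^sub>m X \<in> W)"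
  unfolding submodule_def using M.module_axioms by (auto simp: matrix_vs_simps)

text \<open>The matrices orthogonal to \<open>S\<close> form a submodule, so it contains the span as
  soon as it contains \<open>T\<close>.\<close>

lemma frob_inner_span_eq_0:
  assumes "T \<subseteq> carrier_mat nr nc" "\<forall>t\<in>T. frob_inner nr nc S t = 0" "X \<in> M.span T"
  shows "frob_inner nr nc S X = 0"
proof -
  let ?W = "{X \<in> carrier_mat nr nc. frob_inner nr nc S X = 0}"
  have "submodule class_ring ?W (module_mat TYPE(real) nr nc)"
    unfolding submodule_mat_iff
    by (auto simp: frob_inner_add_right frob_inner_smult_right frob_inner_zero_right)
  hence "M.span T \<subseteq> ?W" using assms by (intro M.span_is_subset) auto
  thus ?thesis using assms by auto
qed

text \<open>Gram-Schmidt, one generator at a time. \<open>S\<close> stays arbitrary because the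
  induction hypothesis is applied twice: to \<open>S\<close> itself and to the new generator
  \<open>t\<close>.\<close>

lemma orthogonal_projection_span:
  assumes "finite T" "T \<subseteq> carrier_mat nr nc" "S \<in> carrier_mat nr nc"
  shows "\<exists>P\<in>M.span T. \<forall>t\<in>T. frob_inner nr nc (S - P) t = 0"
  using assms
proof (induction T arbitrary: S rule: finite_induct)
  case empty
  have "submodule class_ring (M.span {}) (module_mat TYPE(real) nr nc)"
    by (rule M.span_is_submodule) auto
  thus ?case unfolding submodule_mat_iff by auto
next
  case (insert t T)
  have T: "T \<subseteq> carrier_mat nr nc" and t: "t \<in> carrier_mat nr nc" using insert.prems by auto
  have sub: "submodule class_ring (M.span (insert t T)) (module_mat TYPE(real) nr nc)"
    by (rule M.span_is_submodule) (use insert.prems in auto)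
  have mono: "M.span T \<subseteq> M.span (insert t T)" by (rule M.span_is_monotone) auto
  have t_in: "t \<in> M.span (insert t T)" using M.in_own_span[of "insert t T"] insert.prems by auto
  have spT: "M.span T \<subseteq> carrier_mat nr nc" using M.span_is_subset2 T by auto
  obtain Q where Q: "Q \<in> M.span T" "\<forall>u\<in>T. frob_inner nr nc (t - Q) u = 0"
    using insert.IH[OF T t] by auto
  obtain P where P: "P \<in> M.span T" "\<forall>u\<in>T. frob_inner nr nc (S - P) u = 0"
    using insert.IH[OF T insert.prems(2)] by auto
  \<comment> \<open>\<open>r\<close> is the part of \<open>t\<close> orthogonal to the old
    generators, the only new direction.\<close>
  define r where "r = t - Q"
  have c: "Q \<in> carrier_mat nr nc" "P \<in> carrier_mat nr nc" "r \<in> carrier_mat nr nc"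
    using Q P spT t minus_carrier_mat[of Q nr nc t] by (auto simp: r_def)
  have S: "S \<in> carrier_mat nr nc" by (rule insert.prems(2))
  have t_eq: "t = r + Q" using t c by (intro eq_matI) (auto simp: r_def)
  have r_eq: "r = t + (-1) \<cdot>\<^sub>m Q" using t c by (intro eq_matI) (auto simp: r_def)
  have r_in: "r \<in> M.span (insert t T)"
    unfolding r_eq using sub t_in Q(1) mono unfolding submodule_mat_iff by blast
  \<comment> \<open>The Fourier coefficient of \<open>S - P\<close> along \<open>r\<close>. If
    \<open>t\<close> adds no new direction, then \<open>r\<close> is zero and both sides of
    \<open>kr\<close> vanish.\<close>
  define k where "k = frob_inner nr nc (S - P) r / frob_inner nr nc r r"
  have kr: "k * frob_inner nr nc r r = frob_inner nr nc (S - P) r"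
  proof (cases "frob_inner nr nc r r = 0")
    case True
    hence "r = 0\<^sub>m nr nc" using frob_inner_self_eq_0 c by blast
    thus ?thesis by (simp add: frob_inner_zero_right)
  qed (simp add: k_def)
  define P' where "P' = P + k \<cdot>\<^sub>m r"
  have P'_in: "P' \<in> M.span (insert t T)"
    unfolding P'_def using sub r_in P(1) mono unfolding submodule_mat_iff by blast
  have split: "frob_inner nr nc (S - P') u
      = frob_inner nr nc (S - P) u - k * frob_inner nr nc r u" for u
  proof -
    have "S - P' = (S - P) - k \<cdot>\<^sub>m r" using S c by (intro eq_matI) (auto simp: P'_def)
    moreover have "S - P \<in> carrier_mat nr nc" using c(2) by (rule minus_carrier_mat)
    moreover have "k \<cdot>\<^sub>m r \<in> carrier_mat nr nc" using c by simp
    ultimately show ?thesis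
      using c by (simp add: frob_inner_minus_left frob_inner_smult_left)
  qed
  have orth: "\<forall>u\<in>T. frob_inner nr nc (S - P') u = 0"
    using Q(2) P(2) by (auto simp: split r_def)
  have "frob_inner nr nc (S - P') r = 0" by (simp add: split kr)
  \<comment> \<open>Orthogonality to \<open>t = r + Q\<close> is checked on the two summands;
    \<open>Q\<close> lies in the span of the old generators.\<close>
  moreover have "frob_inner nr nc (S - P') Q = 0"
    by (rule frob_inner_span_eq_0[OF T orth Q(1)])
  ultimately have "frob_inner nr nc (S - P') t = 0"
    using c by (subst t_eq) (simp add: frob_inner_add_right)
  with orth P'_in show ?case by auto
qed

text \<open>If \<open>T\<close> spans \<open>W\<close>, an element of \<open>W\<close> orthogonal to
  \<open>T\<close> is orthogonal to itself, hence zero. Conversely, subtracting from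
  \<open>S\<close> its projection \<open>P\<close> leaves an element of \<open>W\<close> orthogonal
  to \<open>T\<close>; it is zero, so \<open>S = P\<close> lies in the span.\<close>

lemma span_eq_iff_orthogonal_trivial:
  assumes "finite T" "T \<subseteq> W" "submodule class_ring W (module_mat TYPE(real) nr nc)"
  shows "M.span T = W \<longleftrightarrow>
    (\<forall>S\<in>W. (\<forall>t\<in>T. frob_inner nr nc S t = 0) \<longrightarrow> S = 0\<^sub>m nr nc)" (is "_ \<longleftrightarrow> ?R")
proof
  have W: "W \<subseteq> carrier_mat nr nc" and T: "T \<subseteq> carrier_mat nr nc"
    using assms unfolding submodule_mat_iff by auto
  {
    assume "M.span T = W"
    thus ?R using frob_inner_span_eq_0[OF T] frob_inner_self_eq_0 W by blast
  next
    assume R: ?R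
    have sub: "M.span T \<subseteq> W" by (rule M.span_is_subset) (use assms in auto)
    moreover have "S \<in> M.span T" if S: "S \<in> W" for S
    proof -
      obtain P where P: "P \<in> M.span T" "\<forall>t\<in>T. frob_inner nr nc (S - P) t = 0"
        using orthogonal_projection_span[OF assms(1) T] S W by blast
      have c: "S \<in> carrier_mat nr nc" "P \<in> carrier_mat nr nc" using S P sub W by auto
      have "S - P = S + (-1) \<cdot>\<^sub>m P" using c by (intro eq_matI) auto
      hence "S - P \<in> W" using S P sub assms(3) unfolding submodule_mat_iff by auto
      hence "S - P = 0\<^sub>m nr nc" using R P by auto
      moreover have "S = (S - P) + P" using c by (intro eq_matI) auto
      ultimately have "S = P" using c by auto
      thus ?thesis using P by auto
    qed
    ultimately show "M.span T = W" by auto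
  }
qed

end

section \<open>Symmetric matrices and congruence\<close>

lemma submodule_sym_mats: "submodule class_ring (sym_mats m) (module_mat TYPE(real) m m)"
proof -
  have "(c \<cdot>\<^sub>m X)\<^sup>T = c \<cdot>\<^sub>m X\<^sup>T" for c :: real and X
    by (rule eq_matI) auto
  thus ?thesis unfolding submodule_mat_iff sym_mats_def by (auto simp: transpose_add)
qed

text \<open>Serves both directions: with the basis matrix it builds \<open>X\<close> from
  \<open>S\<close>, with a left inverse it recovers \<open>S\<close> from \<open>X\<close>.\<close>

lemma congruence_sym_mats:
  assumes C: "C \<in> carrier_mat n m" and S: "S \<in> sym_mats m"
  shows "C * S * C\<^sup>T \<in> sym_mats n"
proof -
  have Sc: "S \<in> carrier_mat m m" and St: "S\<^sup>T = S" using S by (auto simp: sym_mats_def)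
  have "(C * S * C\<^sup>T)\<^sup>T = C * (C * S)\<^sup>T"
    using transpose_mult[of "C * S" n m "C\<^sup>T" n] C Sc by simp
  also have "\<dots> = C * S * C\<^sup>T" using transpose_mult[OF C Sc] C Sc St by simp
  finally show ?thesis using C Sc by (simp add: sym_mats_def)
qed

lemma frob_inner_outer_prod:
  assumes N: "N \<in> carrier_mat n m" and S: "S \<in> carrier_mat m m" and jk: "j < n" "k < n"
  shows "frob_inner m m S (outer_prod (row N j) (row N k)) = (N * S * N\<^sup>T) $$ (j, k)"
proof -
  have "(N * S * N\<^sup>T) $$ (j, k) = (\<Sum>a<m. N $$ (j, a) * (\<Sum>b<m. S $$ (a, b) * N $$ (k, b)))"
    using assms by (simp add: scalar_prod_def lessThan_atLeast0)
  also have "\<dots> = (\<Sum>a<m. \<Sum>b<m. S $$ (a, b) * (N $$ (j, a) * N $$ (k, b)))"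
    by (simp add: sum_distrib_left mult_ac)
  finally show ?thesis using assms by (simp add: frob_inner_def outer_prod_def)
qed

section \<open>Basis matrices, left inverses and column spaces\<close>

text \<open>A nonzero \<open>v\<close> with \<open>A *\<^sub>v v = 0\<^sub>v n\<close> would be a
  dependence among the columns; distinctness makes it a dependence of the set of columns.\<close>

lemma (in vec_space) injective_mult_vec_if_lin_indpt_cols:
  assumes A: "A \<in> carrier_mat n m" and "distinct (cols A)" and li: "lin_indpt (set (cols A))"
    and v: "v \<in> carrier_vec m" "A *\<^sub>v v = 0\<^sub>v n"
  shows "v = 0\<^sub>v m"
  using lin_depI[OF A v(1) _ v(2) assms(2)] li by blast

text \<open>The Gram matrix \<open>N\<^sup>T N\<close> is invertible because \<open>v\<^sup>T N\<^sup>T N v = 0\<close> forces \<open>N v = 0\<close>.\<close>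

lemma left_inverse_if_injective:
  fixes N :: "real mat"
  assumes N: "N \<in> carrier_mat n m"
    and inj: "\<And>v. v \<in> carrier_vec m \<Longrightarrow> N *\<^sub>v v = 0\<^sub>v n \<Longrightarrow> v = 0\<^sub>v m"
  shows "\<exists>L\<in>carrier_mat m n. L * N = 1\<^sub>m m"
proof -
  let ?G = "N\<^sup>T * N"
  have G: "?G \<in> carrier_mat m m" using N by auto
  have "v = 0\<^sub>v m" if v: "v \<in> carrier_vec m" and z: "?G *\<^sub>v v = 0\<^sub>v m" for v
  proof -
    have Nv: "N *\<^sub>v v \<in> carrier_vec n" using N v by auto
    have "N\<^sup>T *\<^sub>v (N *\<^sub>v v) = 0\<^sub>v m" using z N v by simp
    hence "(N\<^sup>T *\<^sub>v (N *\<^sub>v v)) \<bullet> v = 0" using v by simp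
    hence "(N *\<^sub>v v) \<bullet> (N *\<^sub>v v) = 0"
      using transpose_vec_mult_scalar[OF N v Nv] by simp
    hence "\<forall>p\<in>{0..<n}. (N *\<^sub>v v) $ p * (N *\<^sub>v v) $ p = 0"
      using N unfolding scalar_prod_def by (subst (asm) sum_nonneg_eq_0_iff) auto
    hence "N *\<^sub>v v = 0\<^sub>v n" using N Nv
      by (intro eq_vecI) (auto simp del: index_mult_mat_vec)
    thus ?thesis using inj v by auto
  qed
  hence "det ?G \<noteq> 0" unfolding det_0_iff_vec_prod_zero_field[OF G] by blast
  then obtain H where H: "H \<in> carrier_mat m m" "H * ?G = 1\<^sub>m m"
    using det_non_zero_imp_unit[OF G, of "()"] by (auto simp: Units_def ring_mat_simps)
  show ?thesis
    using H N by (intro bexI[of _ "H * N\<^sup>T"]) auto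
qed

text \<open>\<open>N * L\<close> fixes every vector in the column space of \<open>N\<close>, hence
  fixes \<open>X\<close> from the left. Transposing and using the symmetry of \<open>X\<close>, its
  transpose fixes \<open>X\<close> from the right.\<close>

lemma sym_mats_with_cols_in_col_space:
  assumes N: "N \<in> carrier_mat n m" and L: "L \<in> carrier_mat m n" "L * N = 1\<^sub>m m"
    and X: "X \<in> sym_mats n"
    and cols: "\<And>k. k < n \<Longrightarrow> \<exists>y\<in>carrier_vec m. N *\<^sub>v y = col X k"
  shows "\<exists>S\<in>sym_mats m. X = N * S * N\<^sup>T"
proof -
  have Xc: "X \<in> carrier_mat n n" and Xt: "X\<^sup>T = X" using X by (auto simp: sym_mats_def)
  obtain y where y: "\<And>k. k < n \<Longrightarrow> y k \<in> carrier_vec m \<and> N *\<^sub>v y k = col X k"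
    using cols by metis
  define Y where "Y = mat m n (\<lambda>(a, k). y k $ a)"
  have Y: "Y \<in> carrier_mat m n" by (simp add: Y_def)
  have XY: "X = N * Y"
  proof (rule mat_col_eqI)
    fix k assume "k < dim_col (N * Y)"
    hence k: "k < n" using Y by auto
    have "col Y k = y k" using k y[OF k] by (intro eq_vecI) (auto simp: Y_def)
    thus "col X k = col (N * Y) k" using y[OF k] col_mult2[OF N Y k] by simp
  qed (use Xc N Y in auto)
  have LX: "N * (L * X) = X"
  proof -
    have "L * X = L * N * Y" unfolding XY by (rule assoc_mult_mat[OF L(1) N Y, symmetric])
    hence "L * X = Y" using L(2) Y by simp
    thus ?thesis using XY by simp
  qed
  \<comment> \<open>The only candidate: multiplying \<open>N * S * N\<^sup>T\<close> by
    \<open>L\<close> and \<open>L\<^sup>T\<close> from the two sides gives back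
    \<open>S\<close>.\<close>
  define S where "S = L * X * L\<^sup>T"
  have "X = (N * (L * X))\<^sup>T" using LX Xt by simp
  also have "\<dots> = (L * X)\<^sup>T * N\<^sup>T" using N L(1) Xc by (intro transpose_mult) auto
  also have "(L * X)\<^sup>T = X * L\<^sup>T" using transpose_mult[OF L(1) Xc] Xt by simp
  finally have XL: "X * L\<^sup>T * N\<^sup>T = X" by simp
  have "N * S = N * (L * X) * L\<^sup>T"
    unfolding S_def by (rule assoc_mult_mat[symmetric, of _ n m _ n _ m]) (use N L(1) Xc in auto)
  hence "X = N * S * N\<^sup>T" using LX XL by simp
  moreover have "S \<in> sym_mats m"
    unfolding S_def by (rule congruence_sym_mats[OF L(1) X])
  ultimately show ?thesis by blast
qed

text \<open>A basis of the kernel as a vector space of its own is listed without repetition.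
  Independence and span mean the same there as in the ambient space, which
  \<open>cols_form_basis\<close> refers to.\<close>

lemma cols_form_basis_mat_kernel_exists:
  assumes B: "B \<in> carrier_mat nr n"
  shows "\<exists>m N. cols_form_basis n m N (mat_kernel B)"
proof -
  interpret K: kernel nr n B by unfold_locales (rule B)
  obtain V where V: "finite V" "K.basis V" using kernel_basis_exists[OF B] by auto
  obtain vs where vs: "set vs = V" "distinct vs" using finite_distinct_list[OF V(1)] by auto
  have sub: "V \<subseteq> mat_kernel B" and li: "\<not> K.Ker.lin_dep V" and sp: "K.Ker.span V = mat_kernel B"
    using V(2) unfolding K.Ker.basis_def by auto
  have "cols (mat_of_cols n vs) = vs"
    using sub vs mat_kernel_carrier[OF B] by (intro cols_mat_of_cols) auto
  hence "cols_form_basis n (length vs) (mat_of_cols n vs) (mat_kernel B)"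
    unfolding cols_form_basis_def
    using vs li sp K.lindep_same[OF sub] K.span_same[OF sub] by simp
  thus ?thesis by blast
qed

text \<open>The basis property in matrix form: spanning describes \<open>L\<close> as the image of
  \<open>N\<close>, and independence yields a left inverse.\<close>

lemma
  assumes "cols_form_basis n m N L"
  shows cols_form_basis_carrier: "N \<in> carrier_mat n m"
    and cols_form_basis_col_space: "L = {x. \<exists>y\<in>carrier_vec m. N *\<^sub>v y = x}"
    and cols_form_basis_left_inverse: "\<exists>M\<in>carrier_mat m n. M * N = 1\<^sub>m m"
proof -
  interpret V: vec_space "TYPE(real)" n .
  note basis = assms[unfolded cols_form_basis_def]
  show N: "N \<in> carrier_mat n m" using basis by auto
  show "\<exists>M\<in>carrier_mat m n. M * N = 1\<^sub>m m"
    using left_inverse_if_injective[OF N] V.injective_mult_vec_if_lin_indpt_cols[OF N] basis by blast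
  have "L = V.col_space N" using basis by (simp add: V.col_space_def)
  thus "L = {x. \<exists>y\<in>carrier_vec m. N *\<^sub>v y = x}" using V.col_space_eq[OF N] N by auto
qed

section \<open>Row deletion and kernels\<close>

lemma delete_row_carrier:
  "A \<in> carrier_mat n k \<Longrightarrow> delete_row i A \<in> carrier_mat (n - 1) k"
  by (simp add: delete_row_def)

text \<open>Each row of a product depends only on the same row of the left factor. This turns the
  last SNIP condition into one on the kernel of \<open>delete_row i A\<close>.\<close>

lemma delete_row_mult:
  assumes "A \<in> carrier_mat n k" "B \<in> carrier_mat k l" "i < n"
  shows "delete_row i (A * B) = delete_row i A * B"
proof (rule eq_matI)
  fix p q assume "p < dim_row (delete_row i A * B)" "q < dim_col (delete_row i A * B)"
  hence pq: "p < n - 1" "q < l" using assms by (auto simp: delete_row_def)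
  \<comment> \<open>\<open>insert_index i\<close> skips \<open>i\<close>, sending \<open>p\<close>
    to \<open>p\<close> or \<open>p + 1\<close>, so \<open>p < n - 1\<close> keeps it below
    \<open>n\<close>.\<close>
  hence ins: "insert_index i p < n" using assms by (auto simp: insert_index_def)
  have "row (delete_row i A) p = row A (insert_index i p)"
    using assms pq ins by (intro eq_vecI) (auto simp: delete_row_def)
  thus "delete_row i (A * B) $$ (p, q) = (delete_row i A * B) $$ (p, q)"
    using assms pq ins by (simp add: delete_row_def)
qed (use assms in \<open>auto simp: delete_row_def\<close>)

lemma mult_eq_0_iff_cols_in_kernel:
  assumes B: "B \<in> carrier_mat nr n" and X: "X \<in> carrier_mat n l"
  shows "B * X = 0\<^sub>m nr l \<longleftrightarrow> (\<forall>k<l. col X k \<in> mat_kernel B)"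
proof -
  have "B * X = 0\<^sub>m nr l \<longleftrightarrow> (\<forall>k<l. col (B * X) k = 0\<^sub>v nr)" (is "?L \<longleftrightarrow> ?R")
  proof
    assume ?R thus ?L using assms by (intro mat_col_eqI) auto
  qed auto
  thus ?thesis using col_mult2[OF B X] X unfolding mat_kernel[OF B] by auto
qed

section \<open>Hadamard conditions and recipe matrices\<close>

text \<open>The identity forces a zero diagonal, after which the arbitrary diagonal of
  \<open>A\<close> adds no condition. Off the diagonal, \<open>A\<close> is nonzero exactly on the
  edges, so \<open>X\<close> is constrained only there.\<close>

lemma hadamard_zero_iff_graph_mats:
  assumes "A \<in> graph_mats n E" "X \<in> carrier_mat n n" "simple_graph n E"
  shows "hadamard A X = 0\<^sub>m n n \<and> hadamard (1\<^sub>m n) X = 0\<^sub>m n n \<longleftrightarrow>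
    (\<forall>j<n. X $$ (j, j) = 0) \<and> (\<forall>j k. {j, k} \<in> E \<longrightarrow> X $$ (j, k) = 0)" (is "?L \<longleftrightarrow> ?R")
proof -
  have A: "A \<in> carrier_mat n n"
    and nz: "\<And>p q. p < n \<Longrightarrow> q < n \<Longrightarrow> p \<noteq> q \<Longrightarrow> A $$ (p, q) \<noteq> 0 \<longleftrightarrow> {p, q} \<in> E"
    using assms(1) by (auto simp: graph_mats_def sym_mats_def)
  \<comment> \<open>Edges have two elements, so \<open>{j, j}\<close> is never an edge.\<close>
  have E: "j < n \<and> k < n \<and> j \<noteq> k" if "{j, k} \<in> E" for j k
    using that assms(3) by (cases "j = k") (auto simp: simple_graph_def)
  have had: "hadamard C X = 0\<^sub>m n n \<longleftrightarrow> (\<forall>p<n. \<forall>q<n. C $$ (p, q) * X $$ (p, q) = 0)"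
    if "C \<in> carrier_mat n n" for C
    using that by (auto simp: hadamard_def mat_eq_iff)
  have "?L \<longleftrightarrow> (\<forall>p<n. \<forall>q<n. A $$ (p, q) * X $$ (p, q) = 0) \<and> (\<forall>p<n. X $$ (p, p) = 0)"
    unfolding had[OF A] had[OF one_carrier_mat] by auto
  also have "\<dots> \<longleftrightarrow> ?R"
  proof
    assume l: "(\<forall>p<n. \<forall>q<n. A $$ (p, q) * X $$ (p, q) = 0) \<and> (\<forall>p<n. X $$ (p, p) = 0)"
    have "X $$ (j, k) = 0" if "{j, k} \<in> E" for j k
      using l E[OF that] nz[of j k] that by auto
    thus ?R using l by auto
  next
    assume r: ?R
    have "A $$ (p, q) * X $$ (p, q) = 0" if "p < n" "q < n" for p q
      using r nz[OF that] that by (cases "p = q") auto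
    thus "(\<forall>p<n. \<forall>q<n. A $$ (p, q) * X $$ (p, q) = 0) \<and> (\<forall>p<n. X $$ (p, p) = 0)"
      using r by auto
  qed
  finally show ?thesis .
qed

lemma recipe_mats_subset_sym_mats:
  assumes "N \<in> carrier_mat n m"
  shows "recipe_mats n E N \<subseteq> sym_mats m"
proof -
  have c: "outer_prod (row N j) (row N k) \<in> carrier_mat m m" for j k
    using assms by (simp add: outer_prod_def)
  have t: "(outer_prod (row N j) (row N k))\<^sup>T = outer_prod (row N k) (row N j)" for j k
    by (rule eq_matI) (simp_all add: outer_prod_def)
  have "(outer_prod (row N j) (row N k) + outer_prod (row N k) (row N j))\<^sup>T
      = outer_prod (row N j) (row N k) + outer_prod (row N k) (row N j)" for j k
    unfolding transpose_add[OF c c] t by (rule comm_add_mat[OF c c])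
  thus ?thesis using c t by (auto simp: recipe_mats_def sym_mats_def)
qed

lemma finite_recipe_mats:
  assumes "simple_graph n E"
  shows "finite (recipe_mats n E N)"
proof -
  have "recipe_mats n E N \<subseteq> (\<lambda>j. outer_prod (row N j) (row N j)) ` {..<n} \<union>
      (\<lambda>(j, k). outer_prod (row N j) (row N k) + outer_prod (row N k) (row N j)) ` ({..<n} \<times> {..<n})"
    using assms by (fastforce simp: recipe_mats_def simple_graph_def)
  thus ?thesis by (rule finite_subset) auto
qed

text \<open>A vertex matrix pairs with \<open>S\<close> to a diagonal entry of \<open>X\<close>. An
  edge matrix gives the sum of two mirrored entries, which is twice one of them because
  \<open>X\<close> is symmetric.\<close>

lemma orthogonal_recipe_mats_iff:
  assumes N: "N \<in> carrier_mat n m" and S: "S \<in> sym_mats m" and G: "simple_graph n E"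
  defines "X \<equiv> N * S * N\<^sup>T"
  shows "(\<forall>t\<in>recipe_mats n E N. frob_inner m m S t = 0) \<longleftrightarrow>
    (\<forall>j<n. X $$ (j, j) = 0) \<and> (\<forall>j k. {j, k} \<in> E \<longrightarrow> X $$ (j, k) = 0)"
proof -
  have Sc: "S \<in> carrier_mat m m" using S by (auto simp: sym_mats_def)
  have Xc: "X \<in> carrier_mat n n" using N Sc by (auto simp: X_def)
  have "X\<^sup>T = X" using congruence_sym_mats[OF N S] by (simp add: sym_mats_def X_def)
  hence X_swap: "X $$ (k, j) = X $$ (j, k)" if "j < n" "k < n" for j k
    using that Xc by (metis carrier_matD index_transpose_mat(1))
  have E: "j < n \<and> k < n" if "{j, k} \<in> E" for j k
    using that G by (auto simp: simple_graph_def)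
  have edge: "frob_inner m m S (outer_prod (row N j) (row N k) + outer_prod (row N k) (row N j))
      = 2 * X $$ (j, k)" if "{j, k} \<in> E" for j k
  proof -
    have "outer_prod (row N p) (row N q) \<in> carrier_mat m m" for p q
      using N by (simp add: outer_prod_def)
    thus ?thesis
      using E[OF that] X_swap[of j k]
      by (simp add: frob_inner_add_right frob_inner_outer_prod[OF N Sc] X_def)
  qed
  have vertex: "frob_inner m m S (outer_prod (row N j) (row N j)) = X $$ (j, j)" if "j < n" for j
    using that by (simp add: frob_inner_outer_prod[OF N Sc] X_def)
  show ?thesis
    unfolding recipe_mats_def ball_Un using vertex edge by fastforce
qed

section \<open>The equivalence\<close>

text \<open>Proved for every basis matrix \<open>N\<close>; as the left side does not mention
  \<open>N\<close>, the spanning condition is thereby independent of the basis.\<close>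

lemma SNIP_iff_span_recipe_mats:
  assumes G: "simple_graph n E" and i: "i < n" and A: "A \<in> graph_mats n E"
    and basis: "cols_form_basis n m N (mat_kernel (delete_row i A))"
  shows "has_SNIP i A \<longleftrightarrow>
    LinearCombinations.module.span class_ring (module_mat TYPE(real) m m) (recipe_mats n E N)
      = sym_mats m"
proof -
  let ?orth = "\<lambda>S. \<forall>t\<in>recipe_mats n E N. frob_inner m m S t = 0"
  let ?B = "delete_row i A"
  have Ac: "A \<in> carrier_mat n n" using A by (simp add: graph_mats_def sym_mats_def)
  note B = delete_row_carrier[OF Ac, of i]
  note N = cols_form_basis_carrier[OF basis]
  note L = cols_form_basis_col_space[OF basis]
  obtain M where M: "M \<in> carrier_mat m n" "M * N = 1\<^sub>m m"
    using cols_form_basis_left_inverse[OF basis] by blast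
  have ker: "delete_row i (A * X) = 0\<^sub>m (n - 1) n \<longleftrightarrow> (\<forall>k<n. \<exists>y\<in>carrier_vec m. N *\<^sub>v y = col X k)"
    if "X \<in> carrier_mat n n" for X
    unfolding delete_row_mult[OF Ac that i] mult_eq_0_iff_cols_in_kernel[OF B that] L by simp
  \<comment> \<open>The SNIP in terms of entries and columns of \<open>X\<close>, the form that
    matches the conditions on \<open>S\<close>.\<close>
  have SNIP: "has_SNIP i A \<longleftrightarrow> (\<forall>X\<in>sym_mats n.
      ((\<forall>j<n. X $$ (j, j) = 0) \<and> (\<forall>j k. {j, k} \<in> E \<longrightarrow> X $$ (j, k) = 0)) \<and>
      (\<forall>k<n. \<exists>y\<in>carrier_vec m. N *\<^sub>v y = col X k) \<longrightarrow> X = 0\<^sub>m n n)"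
  proof -
    have n: "dim_row A = n" using Ac by auto
    show ?thesis unfolding has_SNIP_def Let_def n
      using hadamard_zero_iff_graph_mats[OF A _ G] ker by (intro ball_cong) (auto simp: sym_mats_def)
  qed
  have "has_SNIP i A \<longleftrightarrow> (\<forall>S\<in>sym_mats m. ?orth S \<longrightarrow> S = 0\<^sub>m m m)"
  proof
    assume snip: "has_SNIP i A"
    show "\<forall>S\<in>sym_mats m. ?orth S \<longrightarrow> S = 0\<^sub>m m m"
    proof (intro ballI impI)
      fix S assume S: "S \<in> sym_mats m" and orth: "?orth S"
      have Sc: "S \<in> carrier_mat m m" using S by (auto simp: sym_mats_def)
      define X where "X = N * S * N\<^sup>T"
      have "X \<in> sym_mats n" unfolding X_def by (rule congruence_sym_mats[OF N S])
      moreover have "\<exists>y\<in>carrier_vec m. N *\<^sub>v y = col X k" if "k < n" for k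
      proof
        have "X = N * (S * N\<^sup>T)" unfolding X_def using N Sc by simp
        thus "N *\<^sub>v col (S * N\<^sup>T) k = col X k"
          using N Sc that by (simp add: col_mult2[of _ n m _ n])
        show "col (S * N\<^sup>T) k \<in> carrier_vec m" using N Sc that by auto
      qed
      ultimately have X0: "X = 0\<^sub>m n n"
        using snip orth orthogonal_recipe_mats_iff[OF N S G] unfolding SNIP X_def by blast
      \<comment> \<open>\<open>S\<close> is recovered from \<open>X = 0\<close> by cancelling
        \<open>N\<close> with \<open>M\<close> on the left and \<open>N\<^sup>T\<close> with
        \<open>M\<^sup>T\<close> on the right.\<close>
      have NM: "N\<^sup>T * M\<^sup>T = 1\<^sub>m m" using M N by (metis transpose_mult transpose_one)
      have "M * X = M * (N * S) * N\<^sup>T"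
        unfolding X_def
        by (rule assoc_mult_mat[symmetric, of _ m n _ m _ n]) (use M(1) N Sc in auto)
      also have "M * (N * S) = S" using assoc_mult_mat[OF M(1) N Sc] M(2) Sc by simp
      finally have "S * N\<^sup>T = 0\<^sub>m m n" using X0 M(1) by simp
      moreover have "S * N\<^sup>T * M\<^sup>T = S"
        using assoc_mult_mat[of S m m "N\<^sup>T" n "M\<^sup>T" m] M(1) N Sc NM by simp
      ultimately show "S = 0\<^sub>m m m" using M(1) by simp
    qed
  next
    assume R: "\<forall>S\<in>sym_mats m. ?orth S \<longrightarrow> S = 0\<^sub>m m m"
    show "has_SNIP i A"
      unfolding SNIP
    proof (intro ballI impI, elim conjE)
      fix X assume X: "X \<in> sym_mats n"
        and X0: "\<forall>j<n. X $$ (j, j) = 0" "\<forall>j k. {j, k} \<in> E \<longrightarrow> X $$ (j, k) = 0"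
        and "\<forall>k<n. \<exists>y\<in>carrier_vec m. N *\<^sub>v y = col X k"
      then obtain S where S: "S \<in> sym_mats m" "X = N * S * N\<^sup>T"
        using sym_mats_with_cols_in_col_space[OF N M X] by blast
      hence "S = 0\<^sub>m m m" using R X0 orthogonal_recipe_mats_iff[OF N S(1) G] by blast
      thus "X = 0\<^sub>m n n" using S(2) N by simp
    qed
  qed
  also have "\<dots> \<longleftrightarrow> LinearCombinations.module.span class_ring (module_mat TYPE(real) m m)
      (recipe_mats n E N) = sym_mats m"
    using span_eq_iff_orthogonal_trivial[OF finite_recipe_mats[OF G]
      recipe_mats_subset_sym_mats[OF N] submodule_sym_mats] by simp
  finally show ?thesis .
qed

theorem theorem7p8:
  fixes n i :: nat and E :: "nat set set" and A :: "real mat"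
  assumes "simple_graph n E" and "i < n" and "A \<in> graph_mats n E"
  shows "has_SNIP i A \<longleftrightarrow> gives_full_recipe n E (mat_kernel (delete_row i A))"
proof -
  have "A \<in> carrier_mat n n" using assms(3) by (simp add: graph_mats_def sym_mats_def)
  \<comment> \<open>From SNIP to recipe some basis has to be exhibited; in the converse the recipe
    supplies one.\<close>
  hence "\<exists>m N. cols_form_basis n m N (mat_kernel (delete_row i A))"
    by (intro cols_form_basis_mat_kernel_exists[OF delete_row_carrier])
  thus ?thesis
    unfolding gives_full_recipe_def using SNIP_iff_span_recipe_mats[OF assms] by blast
qed

end
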